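(* Any data stream algorithm for $\mathtt{SMkM}$ that finds an $\alpha$-approximate solution with probability at least $2/3$ uses memory at least $\Omega\!\left(e^{k/(8\alpha)}/k^2\right)$, assuming $\alpha\le k/(32\ln k)$. This holds even when the task is to find a maximum size common independent set in $k$ partition matroids (i.e. $f(S)=|S|$), and the common rank of these matroids is $O(\alpha)=O(k/\log k)$.
   Context: $\mathtt{SMkM}$ (Submodular Maximization subject to $k$ Matroid Constraints): given $k\ge 2$ matroids $M_1=(\mathcal N,\mathcal I_1),\dots,M_k=(\mathcal N,\mathcal I_k)$ on a common ground set $\mathcal N$ and a non-negative submodular function $f:2^{\mathcal N}\to\mathbb R_{\ge0}$, find a common independent set $S$ (independent in all $k$ matroids) maximizing $f(S)$. The common rank of the matroids is the maximum cardinality of a common independent set. A solution is $\alpha$-approximate ($\alpha\ge1$) if its value is at least $1/\alpha$ times the optimal value. Data stream model: the elements of the ground set arrive one by one in a stream; the (possibly randomized) algorithm makes a single pass and then outputs a common independent set. There is no restriction on computational power; memory is measured in bits. The algorithm has an independence oracle for each individual matroid. In fact, the lower bound is for the following model, in which the oracles leak nothing: a "super ground set" together with the matroids and the objective function over it is fully known to the algorithm upfront (unrestricted oracle access), and the actual ground set is a subset of the super ground set whose elements are revealed by the stream. The constants hidden in $\Omega(\cdot)$, $O(\cdot)$ are absolute. *)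

theory Defs
  imports "HOL-Probability.Probability"
begin

section \<open>Matroids\<close>

definition matroid :: "'a set \<Rightarrow> 'a set set \<Rightarrow> bool" where
  "matroid N I \<longleftrightarrow>
     finite N \<and> I \<subseteq> Pow N \<and> {} \<in> I \<and>
     (\<forall>A B. B \<in> I \<and> A \<subseteq> B \<longrightarrow> A \<in> I) \<and>
     (\<forall>A B. A \<in> I \<and> B \<in> I \<and> card A < card B \<longrightarrow> (\<exists>x\<in>B - A. insert x A \<in> I))"

text \<open>
  Every class has capacity one. Partition matroids are also defined in the literature with
  arbitrary capacities; the lower bound below asserts the existence of hard instances, so the
  narrower class gives the stronger statement.
\<close>

definition partition_matroid :: "'a set \<Rightarrow> 'a set set \<Rightarrow> bool" where
  "partition_matroid N I \<longleftrightarrow>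
     finite N \<and> (\<exists>P. partition_on N P \<and> I = {S. S \<subseteq> N \<and> (\<forall>X\<in>P. card (S \<inter> X) \<le> 1)})"


section \<open>Submodular maximization subject to \<open>k\<close> matroid constraints\<close>

definition submodular_on :: "'a set \<Rightarrow> ('a set \<Rightarrow> real) \<Rightarrow> bool" where
  "submodular_on N f \<longleftrightarrow>
     (\<forall>A B. A \<subseteq> N \<and> B \<subseteq> N \<longrightarrow> f (A \<union> B) + f (A \<inter> B) \<le> f A + f B)"

text \<open>The matroids of an instance are \<open>I 0, \<dots>, I (k - 1)\<close>; other values of \<open>I\<close> are irrelevant.\<close>

definition smkm_instance ::
  "nat \<Rightarrow> 'a set \<Rightarrow> (nat \<Rightarrow> 'a set set) \<Rightarrow> ('a set \<Rightarrow> real) \<Rightarrow> bool" where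
  "smkm_instance k N I f \<longleftrightarrow>
     2 \<le> k \<and> (\<forall>i<k. matroid N (I i)) \<and> (\<forall>S. S \<subseteq> N \<longrightarrow> 0 \<le> f S) \<and> submodular_on N f"

text \<open>
  \<open>N\<close> is the super ground set; the actual ground set \<open>E \<subseteq> N\<close> consists of the streamed elements,
  with the matroids and \<open>f\<close> restricted to \<open>E\<close>.
\<close>

definition common_indep :: "nat \<Rightarrow> (nat \<Rightarrow> 'a set set) \<Rightarrow> 'a set \<Rightarrow> 'a set set" where
  "common_indep k I E = {S. S \<subseteq> E \<and> (\<forall>i<k. S \<in> I i)}"

definition common_rank :: "nat \<Rightarrow> (nat \<Rightarrow> 'a set set) \<Rightarrow> 'a set \<Rightarrow> nat" where
  "common_rank k I E = Max (card ` common_indep k I E)"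

definition opt :: "nat \<Rightarrow> (nat \<Rightarrow> 'a set set) \<Rightarrow> ('a set \<Rightarrow> real) \<Rightarrow> 'a set \<Rightarrow> real" where
  "opt k I f E = Max (f ` common_indep k I E)"

definition approx_solution ::
  "real \<Rightarrow> nat \<Rightarrow> (nat \<Rightarrow> 'a set set) \<Rightarrow> ('a set \<Rightarrow> real) \<Rightarrow> 'a set \<Rightarrow> 'a set \<Rightarrow> bool" where
  "approx_solution \<alpha> k I f E S \<longleftrightarrow> S \<in> common_indep k I E \<and> f S \<ge> opt k I f E / \<alpha>"


section \<open>Single-pass data stream algorithms\<close>

text \<open>
  A deterministic algorithm carries only a bit string from one stream element to the next, and
  its output is computed from the final bit string. There is no bound on the computation done in
  between. The argument of type \<^typ>\<open>nat\<close> is the number of elements read so far; this clock is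
  not charged as memory.
\<close>

record 'a stream_machine =
  start :: "bool list"
  step :: "nat \<Rightarrow> bool list \<Rightarrow> 'a \<Rightarrow> bool list"
  result :: "nat \<Rightarrow> bool list \<Rightarrow> 'a set"

definition final_memory :: "'a stream_machine \<Rightarrow> 'a list \<Rightarrow> bool list" where
  "final_memory M xs = fold (\<lambda>(t, x) s. step M t s x) (List.enumerate 0 xs) (start M)"

definition answer :: "'a stream_machine \<Rightarrow> 'a list \<Rightarrow> 'a set" where
  "answer M xs = result M (length xs) (final_memory M xs)"

definition streams_of :: "'a set \<Rightarrow> 'a list set" where
  "streams_of N = {xs. distinct xs \<and> set xs \<subseteq> N}"

text \<open>
  A randomized algorithm is a distribution over deterministic ones. Random bits are thus neither
  charged as memory nor lost after use, and because of the clock they include fresh coin flips at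
  every step. A discrete distribution suffices, since on a finite super ground set with bounded
  memory only finitely many behaviours can be distinguished.
\<close>

type_synonym 'a stream_algorithm = "'a stream_machine pmf"

text \<open>
  \<^const>\<open>streams_of\<close> is closed under prefixes, so the bound also covers the memory contents
  at all intermediate times.
\<close>

definition uses_memory_at_most :: "'a stream_algorithm \<Rightarrow> 'a set \<Rightarrow> nat \<Rightarrow> bool" where
  "uses_memory_at_most A N b \<longleftrightarrow>
     (\<forall>M\<in>set_pmf A. \<forall>xs\<in>streams_of N. length (final_memory M xs) \<le> b)"

definition finds_approx_solution ::
  "'a stream_algorithm \<Rightarrow> real \<Rightarrow> nat \<Rightarrow> 'a set \<Rightarrow> (nat \<Rightarrow> 'a set set) \<Rightarrow> ('a set \<Rightarrow> real) \<Rightarrow> bool"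
where
  "finds_approx_solution A \<alpha> k N I f \<longleftrightarrow>
     (\<forall>xs\<in>streams_of N.
        measure_pmf.prob A {M. approx_solution \<alpha> k I f (set xs) (answer M xs)} \<ge> 2 / 3)"

end

(*
  The hard instance has p players, where \<alpha> < p \<le> 2\<alpha>, and n items, and each player has a copy of
  every item. Colour the copies in each of the k matroids by the player plus a shift mod p that
  depends on the item. Copies of one item then never conflict, and for suitable shifts copies of
  different items always conflict in some matroid; such shifts exist for n up to e^(k/p) / p^2.
  Each player streams a random subset of its own share of the items, the shares being
  disjoint, together with one common planted item. The copies of the planted item form a solution
  of size p > \<alpha>, and any common independent set of size at least 2 reveals the planted item.

  Hybrid argument: remove the planted item from the players one by one. Given the
  memory before player i, the planted item is a uniformly random one among the m + 1 items that
  this player may hold, so by Massart's finite class lemma a memory of b bits after the player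
  detects its presence with advantage about sqrt (b / m). Without detection the memory does not
  identify the planted item. Hence b is at least of order m / p^2 with m about n / p, up to lower
  order terms for the clock. This exceeds the claimed bound, since p \<le> 2\<alpha> makes e^(k/p) at least
  the fourth power of e^(k/(8\<alpha>)).
*)
theory Submission
  imports Defs
begin

section \<open>A finite class lemma for random signs\<close>

text \<open>In the quadratic upper bounds for \<open>exp y\<close> and \<open>exp (- y)\<close> the
  linear terms cancel. This bounds the exponential moment of one random sign; the sharper exponent
  \<open>x\<^sup>2 / 2\<close> would only improve constants.\<close>

lemma exp_plus_exp_minus_le:
  fixes x :: real
  assumes "\<bar>x\<bar> \<le> 1"
  shows "exp x + exp (- x) \<le> 2 * exp (x\<^sup>2)"
proof -
  have *: "exp y + exp (- y) \<le> 2 * exp (y\<^sup>2)" if "0 \<le> y" "y \<le> 1" for y :: real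
  proof -
    have "exp y \<le> 1 + y + y\<^sup>2"
      using that by (rule exp_bound)
    moreover have "exp (- y) \<le> 1 - y + y\<^sup>2"
    proof -
      \<comment> \<open>The product equals \<open>1 + y ^ 3\<close>.\<close>
      have "1 \<le> (1 - y + y\<^sup>2) * (1 + y)"
        using that by (simp add: algebra_simps power2_eq_square)
      also have "\<dots> \<le> (1 - y + y\<^sup>2) * exp y"
        using that by (intro mult_left_mono) auto
      finally show ?thesis
        by (simp add: exp_minus field_simps)
    qed
    moreover have "1 + y\<^sup>2 \<le> exp (y\<^sup>2)"
      by (rule exp_ge_add_one_self)
    ultimately show ?thesis
      by linarith
  qed
  show ?thesis
    using *[of x] *[of "- x"] assms by (cases "x \<ge> 0") auto
qed

text \<open>Independent random signs: expanding the product chooses one of the two exponentials for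
  each \<open>q\<close>, and \<open>U\<close> records where the positive one was taken.\<close>

lemma sum_exp_signed_sum:
  fixes c :: "'a \<Rightarrow> real"
  assumes "finite D"
  shows "(\<Sum>U\<in>Pow D. exp (\<Sum>q\<in>D. if q \<in> U then c q else - c q)) =
         (\<Prod>q\<in>D. exp (c q) + exp (- c q))"
proof -
  have "exp (\<Sum>q\<in>D. if q \<in> U then c q else - c q) =
        (\<Prod>q\<in>U. exp (c q)) * (\<Prod>q\<in>D - U. exp (- c q))" if "U \<in> Pow D" for U
  proof -
    have "finite U" "U \<subseteq> D"
      using that assms finite_subset by auto
    have "(\<Sum>q\<in>D. if q \<in> U then c q else - c q) = (\<Sum>q\<in>D - U. - c q) + (\<Sum>q\<in>U. c q)"
      by (subst sum.subset_diff[OF \<open>U \<subseteq> D\<close> assms]) (auto intro!: arg_cong2[where f="(+)"] sum.cong)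
    thus ?thesis
      using \<open>finite U\<close> assms by (simp add: exp_add exp_sum mult.commute)
  qed
  thus ?thesis
    using prod_add[OF assms, of "\<lambda>q. exp (c q)" "\<lambda>q. exp (- c q)"] by simp
qed

text \<open>
  Massart's finite class lemma: the weights of the random signs may depend on the signs themselves,
  but only through \<open>g\<close>, which takes at most \<open>K\<close> values.
\<close>

lemma sum_signed_le:
  fixes a :: "'s \<Rightarrow> 'a \<Rightarrow> real" and g :: "'a set \<Rightarrow> 's"
  assumes fin: "finite D"
    and S: "finite S" "g ` Pow D \<subseteq> S" "real (card S) \<le> K"
    and t: "0 < t" "t \<le> 1"
    and a: "\<And>s q. \<bar>a s q\<bar> \<le> 1"
  shows "(\<Sum>U\<in>Pow D. \<Sum>q\<in>D. if q \<in> U then a (g U) q else - a (g U) q)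
           \<le> 2 ^ card D * (ln K / t + t * card D)"
proof -
  define h where "h s U = (\<Sum>q\<in>D. if q \<in> U then t * a s q else - (t * a s q))" for s U
  define y where "y = (\<Sum>U\<in>Pow D. h (g U) U) / 2 ^ card D"
  have cP: "real (card (Pow D)) = 2 ^ card D"
    using fin by (simp add: card_Pow)
  have "card S > 0"
    using S by (auto simp: card_gt_0_iff)
  hence K: "K > 0"
    using S by linarith
  \<comment> \<open>Jensen's inequality for \<open>exp\<close>, by its tangent at the mean
    \<open>y\<close>: the deviations \<open>h (g U) U - y\<close> sum to zero.\<close>
  have "2 ^ card D * exp y = (\<Sum>U\<in>Pow D. exp y * (1 + h (g U) U - y))"
  proof -
    have "(\<Sum>U\<in>Pow D. 1 + h (g U) U - y) = 2 ^ card D"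
      using cP by (simp add: sum.distrib sum_subtractf y_def)
    thus ?thesis
      by (simp add: sum_distrib_left[symmetric])
  qed
  also have "\<dots> \<le> (\<Sum>U\<in>Pow D. exp (h (g U) U))"
  proof (rule sum_mono)
    fix U
    have "exp y * (1 + (h (g U) U - y)) \<le> exp y * exp (h (g U) U - y)"
      by (intro mult_left_mono exp_ge_add_one_self) auto
    thus "exp y * (1 + h (g U) U - y) \<le> exp (h (g U) U)"
      by (simp add: exp_add[symmetric] algebra_simps)
  qed
  \<comment> \<open>Union bound: summing over all \<open>s\<close> decouples the weights from the
    signs, at the cost of a factor \<open>card S\<close>.\<close>
  also have "\<dots> \<le> (\<Sum>U\<in>Pow D. \<Sum>s\<in>S. exp (h s U))"
    using S by (intro sum_mono member_le_sum) auto
  also have "\<dots> = (\<Sum>s\<in>S. \<Sum>U\<in>Pow D. exp (h s U))"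
    by (rule sum.swap)
  also have "\<dots> \<le> (\<Sum>s\<in>S. (2 * exp (t\<^sup>2)) ^ card D)"
  proof (rule sum_mono)
    fix s
    have "(\<Sum>U\<in>Pow D. exp (h s U)) = (\<Prod>q\<in>D. exp (t * a s q) + exp (- (t * a s q)))"
      unfolding h_def by (rule sum_exp_signed_sum[OF fin])
    also have "\<dots> \<le> (\<Prod>q\<in>D. 2 * exp (t\<^sup>2))"
    proof (intro prod_mono conjI)
      fix q
      have ta: "\<bar>t * a s q\<bar> \<le> t"
        using t a[of s q] mult_left_mono[of "\<bar>a s q\<bar>" 1 t] by (simp add: abs_mult)
      hence "exp (t * a s q) + exp (- (t * a s q)) \<le> 2 * exp ((t * a s q)\<^sup>2)"
        using t by (intro exp_plus_exp_minus_le) linarith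
      also have "(t * a s q)\<^sup>2 \<le> t\<^sup>2"
        using ta t by (intro power2_le_iff_abs_le[THEN iffD2]) auto
      hence "2 * exp ((t * a s q)\<^sup>2) \<le> 2 * exp (t\<^sup>2)"
        by simp
      finally show "exp (t * a s q) + exp (- (t * a s q)) \<le> 2 * exp (t\<^sup>2)" .
    qed (auto intro: add_nonneg_nonneg)
    finally show "(\<Sum>U\<in>Pow D. exp (h s U)) \<le> (2 * exp (t\<^sup>2)) ^ card D"
      by simp
  qed
  also have "\<dots> = card S * (2 * exp (t\<^sup>2)) ^ card D"
    by simp
  also have "\<dots> \<le> K * (2 * exp (t\<^sup>2)) ^ card D"
    using S by (intro mult_right_mono) auto
  finally have "2 ^ card D * exp y \<le> 2 ^ card D * (K * exp (t\<^sup>2) ^ card D)"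
    by (simp add: power_mult_distrib)
  hence "exp y \<le> K * exp (t\<^sup>2) ^ card D"
    by simp
  also have "\<dots> = exp (ln K + card D * t\<^sup>2)"
    using K by (simp add: exp_add exp_of_nat_mult)
  finally have "y \<le> ln K + card D * t\<^sup>2"
    by simp
  moreover have "(\<Sum>U\<in>Pow D. h (g U) U) =
      t * (\<Sum>U\<in>Pow D. \<Sum>q\<in>D. if q \<in> U then a (g U) q else - a (g U) q)"
    unfolding h_def sum_distrib_left by (intro sum.cong) auto
  ultimately show ?thesis
    using t by (simp add: y_def field_simps power2_eq_square)
qed

section \<open>Codes in which any two shifted codewords collide\<close>

lemma card_avoiding_vectors:
  assumes "c < p" "2 \<le> (p::nat)"
  shows "card {w\<in>{..<p}. (b + w) mod p \<noteq> c} \<le> p - 1"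
proof -
  \<comment> \<open>The coordinate that does collide with \<open>c\<close> after the shift by
    \<open>b\<close>.\<close>
  define w where "w = (c + (p - b mod p)) mod p"
  have "w < p"
    using assms by (simp add: w_def)
  have "(b + w) mod p = (b mod p + (c + (p - b mod p))) mod p"
    by (simp add: w_def mod_simps)
  also have "b mod p + (c + (p - b mod p)) = c + p"
    using assms mod_less_divisor[of p b] by linarith
  finally have "(b + w) mod p = c"
    using assms by simp
  hence "{w\<in>{..<p}. (b + w) mod p \<noteq> c} \<subseteq> {..<p} - {w}"
    by auto
  hence "card {w\<in>{..<p}. (b + w) mod p \<noteq> c} \<le> card ({..<p} - {w})"
    by (intro card_mono) auto
  thus ?thesis
    using \<open>w < p\<close> by simp
qed

text \<open>
  Greedy code construction: for each of the earlier codewords and each pair of shifts \<open>a\<close>, \<open>b\<close>,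
  at most \<open>(p - 1) ^ k\<close> vectors fail to collide.
\<close>

lemma exists_colliding_code:
  assumes "2 \<le> (p::nat)" "n * p\<^sup>2 * (p - 1) ^ k < p ^ k"
  shows "\<exists>r::nat \<Rightarrow> nat \<Rightarrow> nat. \<forall>j<n. \<forall>j'<n. j \<noteq> j' \<longrightarrow>
           (\<forall>a<p. \<forall>b<p. \<exists>l<k. (a + r j l) mod p = (b + r j' l) mod p)"
  using assms(2)
proof (induction n)
  case (Suc n)
  have "n * p\<^sup>2 * (p - 1) ^ k \<le> Suc n * p\<^sup>2 * (p - 1) ^ k"
    by (intro mult_right_mono) auto
  from Suc.IH[OF order_le_less_trans[OF this Suc.prems]] obtain r :: "nat \<Rightarrow> nat \<Rightarrow> nat" where r:
    "\<And>j j' a b. j < n \<Longrightarrow> j' < n \<Longrightarrow> j \<noteq> j' \<Longrightarrow> a < p \<Longrightarrow> b < p \<Longrightarrow>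
       \<exists>l<k. (a + r j l) mod p = (b + r j' l) mod p"
    by blast
  define bad where "bad = (\<lambda>(j, a, b).
    PiE {..<k} (\<lambda>l. {w\<in>{..<p}. (b + w) mod p \<noteq> (a + r j l) mod p}))"
  define X where "X = {..<n} \<times> {..<p} \<times> {..<p}"
  have finite_bad: "finite (\<Union> (bad ` X))"
    by (auto simp: X_def bad_def intro!: finite_PiE)
  have "card (\<Union> (bad ` X)) \<le> (\<Sum>x\<in>X. card (bad x))"
    by (rule card_UN_le) (auto simp: X_def)
  also have "\<dots> \<le> (\<Sum>x\<in>X. (p - 1) ^ k)"
  proof (rule sum_mono)
    fix x :: "nat \<times> nat \<times> nat"
    obtain j a b where x: "x = (j, a, b)"
      by (cases x)
    have "card (bad x) = (\<Prod>l<k. card {w\<in>{..<p}. (b + w) mod p \<noteq> (a + r j l) mod p})"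
      by (simp add: bad_def x card_PiE)
    also have "\<dots> \<le> (\<Prod>l<k. p - 1)"
      using assms(1) by (intro prod_mono conjI card_avoiding_vectors) auto
    finally show "card (bad x) \<le> (p - 1) ^ k"
      by simp
  qed
  also have "\<dots> = n * p\<^sup>2 * (p - 1) ^ k"
    by (simp add: X_def card_cartesian_product power2_eq_square)
  also have "\<dots> \<le> Suc n * p\<^sup>2 * (p - 1) ^ k"
    by (intro mult_right_mono) auto
  also have "\<dots> < p ^ k"
    by (rule Suc.prems)
  also have "p ^ k = card (PiE {..<k} (\<lambda>_. {..<p}))"
    by (simp add: card_PiE)
  finally have "\<not> PiE {..<k} (\<lambda>_. {..<p}) \<subseteq> \<Union> (bad ` X)"
    using card_mono[OF finite_bad] by (meson linorder_not_less)
  then obtain v where v: "v \<in> PiE {..<k} (\<lambda>_. {..<p})" "v \<notin> \<Union> (bad ` X)"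
    by blast
  have *: "\<exists>l<k. (a + r j l) mod p = (b + v l) mod p" if "j < n" "a < p" "b < p" for j a b
  proof -
    have "v \<notin> bad (j, a, b)"
      using v(2) that by (auto simp: X_def)
    thus ?thesis
      using v(1) by (auto simp: bad_def PiE_iff)
  qed
  show ?case
  proof (rule exI[of _ "r(n := v)"], intro allI impI)
    fix j j' a b assume "j < Suc n" "j' < Suc n" "j \<noteq> j'" "a < p" "b < p"
    then consider "j < n" "j' < n" | "j < n" "j' = n" | "j = n" "j' < n"
      by linarith
    thus "\<exists>l<k. (a + (r(n := v)) j l) mod p = (b + (r(n := v)) j' l) mod p"
    proof cases
      case 1
      thus ?thesis
        using r[of j j' a b] \<open>j \<noteq> j'\<close> \<open>a < p\<close> \<open>b < p\<close> by auto
    next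
      case 2
      thus ?thesis
        using *[of j a b] \<open>a < p\<close> \<open>b < p\<close> by auto
    next
      case 3
      obtain l where "l < k" "(b + r j' l) mod p = (a + v l) mod p"
        using *[of j' b a] 3 \<open>a < p\<close> \<open>b < p\<close> by auto
      thus ?thesis
        using 3 by (intro exI[of _ l]) auto
    qed
  qed
qed auto

text \<open>The counting condition follows from
  \<open>(1 - 1 / p) ^ k \<le> exp (- k / p)\<close>.\<close>

lemma exists_colliding_code_exp:
  assumes "2 \<le> (p::nat)" "real (n * p\<^sup>2) < exp (real k / real p)"
  shows "\<exists>r::nat \<Rightarrow> nat \<Rightarrow> nat. \<forall>j<n. \<forall>j'<n. j \<noteq> j' \<longrightarrow>
           (\<forall>a<p. \<forall>b<p. \<exists>l<k. (a + r j l) mod p = (b + r j' l) mod p)"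
proof (rule exists_colliding_code)
  have "(1 - 1 / real p) ^ k \<le> exp (- (1 / real p)) ^ k"
    using assms(1) exp_ge_add_one_self[of "- (1 / real p)"] by (intro power_mono) auto
  also have "\<dots> = exp (- (real k / real p))"
    by (simp add: exp_of_nat_mult[symmetric])
  finally have "real p ^ k * (1 - 1 / real p) ^ k \<le> real p ^ k * exp (- (real k / real p))"
    by (intro mult_left_mono) auto
  also have "real p ^ k * (1 - 1 / real p) ^ k = (real p - 1) ^ k"
    using assms(1) by (simp add: power_mult_distrib[symmetric] right_diff_distrib)
  finally have "(real p - 1) ^ k \<le> real p ^ k * exp (- (real k / real p))" .
  hence "real (n * p\<^sup>2) * (real p - 1) ^ k \<le> real (n * p\<^sup>2) * (real p ^ k * exp (- (real k / real p)))"
    by (intro mult_left_mono) auto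
  also have "\<dots> = (real (n * p\<^sup>2) * exp (- (real k / real p))) * real p ^ k"
    by simp
  also have "\<dots> < 1 * real p ^ k"
    using assms by (intro mult_strict_right_mono) (auto simp: exp_minus field_simps)
  finally have "real (n * p\<^sup>2 * (p - 1) ^ k) < real (p ^ k)"
    using assms(1) by simp
  thus "n * p\<^sup>2 * (p - 1) ^ k < p ^ k"
    by (simp only: of_nat_less_iff)
qed (fact assms(1))

section \<open>Partition matroids from colourings\<close>

text \<open>The partition matroid whose classes are the fibres of \<open>c\<close>. Injectivity
  replaces an explicit partition.\<close>

definition transversals :: "'a set \<Rightarrow> ('a \<Rightarrow> 'b) \<Rightarrow> 'a set set" where
  "transversals N c = {S. S \<subseteq> N \<and> inj_on c S}"

text \<open>Augmentation is pigeonhole on colours: the larger set uses a colour that the smaller one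
  misses.\<close>

lemma matroid_transversals:
  assumes "finite N"
  shows "matroid N (transversals N c)"
  unfolding matroid_def
proof (intro conjI allI impI)
  fix A B assume *: "A \<in> transversals N c \<and> B \<in> transversals N c \<and> card A < card B"
  hence "finite A" "finite B"
    using assms finite_subset by (auto simp: transversals_def)
  have "card (c ` A) < card (c ` B)"
    using * by (simp add: transversals_def card_image)
  hence "\<not> c ` B \<subseteq> c ` A"
    using \<open>finite A\<close> by (meson card_mono finite_imageI linorder_not_less)
  then obtain x where "x \<in> B" "c x \<notin> c ` A"
    by blast
  thus "\<exists>x\<in>B - A. insert x A \<in> transversals N c"
    using * by (intro bexI[of _ x]) (auto simp: transversals_def)
qed (use assms in \<open>auto simp: transversals_def intro: inj_on_subset\<close>)

lemma partition_matroid_transversals: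
  assumes "finite N"
  shows "partition_matroid N (transversals N c)"
  unfolding partition_matroid_def
proof (intro conjI exI)
  define P where "P = (\<lambda>x. {y\<in>N. c y = c x}) ` N"
  show "partition_on N P"
    by (rule partition_onI) (auto simp: P_def disjnt_def)
  have "inj_on c S \<longleftrightarrow> (\<forall>X\<in>P. card (S \<inter> X) \<le> 1)" if "S \<subseteq> N" for S
  proof -
    have "finite (S \<inter> X)" for X
      using assms that finite_subset by blast
    hence "(\<forall>X\<in>P. card (S \<inter> X) \<le> 1) \<longleftrightarrow> (\<forall>X\<in>P. \<forall>x\<in>S \<inter> X. \<forall>y\<in>S \<inter> X. x = y)"
      by (simp add: card_le_Suc0_iff_eq)
    also have "\<dots> \<longleftrightarrow> inj_on c S"
      using that by (auto simp: P_def inj_on_def)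
    finally show ?thesis ..
  qed
  thus "transversals N c = {S. S \<subseteq> N \<and> (\<forall>X\<in>P. card (S \<inter> X) \<le> 1)}"
    by (auto simp: transversals_def)
qed (fact assms)

lemma submodular_on_card:
  assumes "finite N"
  shows "submodular_on N (\<lambda>S. real (card S))"
  unfolding submodular_on_def
proof (intro allI impI)
  fix A B assume "A \<subseteq> N \<and> B \<subseteq> N"
  hence "finite A" "finite B"
    using assms finite_subset by auto
  thus "real (card (A \<union> B)) + real (card (A \<inter> B)) \<le> real (card A) + real (card B)"
    using card_Un_Int[of A B] by simp
qed

text \<open>
  The number \<open>i + p * j\<close> stands for the copy of item \<open>j\<close> held by player \<open>i < p\<close>.
\<close>

definition colour :: "nat \<Rightarrow> (nat \<Rightarrow> nat \<Rightarrow> nat) \<Rightarrow> nat \<Rightarrow> nat \<Rightarrow> nat" where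
  "colour p r l x = (x mod p + r (x div p) l) mod p"

section \<open>Conflicts between copies of items\<close>

lemma mod_add_right_cancel:
  assumes "a < p" "b < p" "(a + c) mod p = (b + c) mod (p::nat)"
  shows "a = b"
proof -
  have *: "y = x" if "x \<le> y" "y < p" "(x + c) mod p = (y + c) mod p" for x y
  proof -
    have "p dvd (y + c) - (x + c)"
      using that by (subst mod_eq_dvd_iff_nat[symmetric]) auto
    thus ?thesis
      using that nat_dvd_not_less[of "y - x" p] by (cases "x = y") auto
  qed
  show ?thesis
    using *[of a b] *[of b a] assms by (metis nat_le_linear)
qed

text \<open>Copies of one item are all shifted by the same amount, and a shift is injective on
  residues mod \<open>p\<close>.\<close>

lemma inj_on_colour:
  assumes "p > 0" and "\<And>x. x \<in> S \<Longrightarrow> x div p = j"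
  shows "inj_on (colour p r l) S"
proof (rule inj_onI)
  fix x y assume xy: "x \<in> S" "y \<in> S" "colour p r l x = colour p r l y"
  hence "(x mod p + r j l) mod p = (y mod p + r j l) mod p"
    by (simp only: colour_def assms(2)[OF xy(1)] assms(2)[OF xy(2)])
  hence "x mod p = y mod p"
    using assms(1) mod_add_right_cancel[of "x mod p" p "y mod p" "r j l"] mod_less_divisor by blast
  moreover have "x div p = y div p"
    using assms(2)[OF xy(1)] assms(2)[OF xy(2)] by simp
  ultimately show "x = y"
    by (metis div_mult_mod_eq)
qed

text \<open>The players \<open>x mod p\<close> and \<open>y mod p\<close> act as the shifts
  \<open>a\<close> and \<open>b\<close> of the code, so a collision of codewords is a shared colour
  of two copies.\<close>

lemma same_item_if_inj_on_colours:
  assumes r: "\<And>j j' a b. j < n \<Longrightarrow> j' < n \<Longrightarrow> j \<noteq> j' \<Longrightarrow> a < p \<Longrightarrow> b < p \<Longrightarrow>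
                \<exists>l<k. (a + r j l) mod p = (b + r j' l) mod p"
    and S: "S \<subseteq> {..<p * n}" "\<And>l. l < k \<Longrightarrow> inj_on (colour p r l) S"
    and xy: "x \<in> S" "y \<in> S"
  shows "x div p = y div p"
proof (rule ccontr)
  assume neq: "x div p \<noteq> y div p"
  have "x < p * n" "y < p * n"
    using S xy by auto
  hence "p > 0" "x div p < n" "y div p < n"
    by (auto simp: less_mult_imp_div_less mult.commute intro: gr0I)
  then obtain l where "l < k" "colour p r l x = colour p r l y"
    using r[of "x div p" "y div p" "x mod p" "y mod p"] neq by (auto simp: colour_def)
  hence "x = y"
    using S(2) xy by (auto dest: inj_onD)
  thus False
    using neq by simp
qed

text \<open>A single matroid already gives this bound on the common rank, since it has only
  \<open>p\<close> colours.\<close>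

lemma card_common_indep_colour_le:
  assumes "0 < k" "0 < p" "S \<in> common_indep k (\<lambda>l. transversals N (colour p r l)) E"
  shows "card S \<le> p"
proof -
  have "inj_on (colour p r 0) S"
    using assms by (auto simp: common_indep_def transversals_def)
  moreover have "colour p r 0 ` S \<subseteq> {..<p}"
    using assms(2) by (auto simp: colour_def)
  ultimately show ?thesis
    using card_inj_on_le[of "colour p r 0" S "{..<p}"] by simp
qed

section \<open>Streams with a planted item\<close>

text \<open>The clock is part of the state, so a run can resume in the middle of a stream;
  \<open>final_memory\<close> always starts at time 0.\<close>

definition run :: "'a stream_machine \<Rightarrow> 'a list \<Rightarrow> nat \<times> bool list \<Rightarrow> nat \<times> bool list" where
  "run M xs s = fold (\<lambda>x (t, w). (Suc t, step M t w x)) xs s"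

lemma run_append: "run M (xs @ ys) s = run M ys (run M xs s)"
  by (simp add: run_def)

lemma run_eq_final_memory: "run M xs (0, start M) = (length xs, final_memory M xs)"
proof (induction xs rule: rev_induct)
  case (snoc x xs)
  thus ?case
    by (simp add: run_append final_memory_def enumerate_append_eq) (simp add: run_def)
qed (simp_all add: run_def final_memory_def)

lemma answer_append:
  "answer M (xs @ ys) = case_prod (result M) (run M ys (run M xs (0, start M)))"
  using run_eq_final_memory[of M "xs @ ys"] by (simp add: answer_def run_append[symmetric])

section \<open>Streams assembled from the players' sets\<close>

definition copies :: "nat \<Rightarrow> nat \<Rightarrow> nat set \<Rightarrow> nat list" where
  "copies p l T = map (\<lambda>j. l + p * j) (sorted_list_of_set T)"

definition segment :: "nat \<Rightarrow> (nat \<Rightarrow> nat set) \<Rightarrow> nat \<Rightarrow> nat \<Rightarrow> nat list" where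
  "segment p T a b = concat (map (\<lambda>l. copies p l (T l)) [a..<b])"

lemma segment_cong:
  "(\<And>l. a \<le> l \<Longrightarrow> l < b \<Longrightarrow> T l = T' l) \<Longrightarrow> segment p T a b = segment p T' a b"
  by (auto simp: segment_def intro!: arg_cong[where f=concat])

lemma segment_split:
  assumes "a \<le> i" "i < b"
  shows "segment p T a b = segment p T a i @ copies p i (T i) @ segment p T (Suc i) b"
proof -
  have "[a..<b] = [a..<i] @ i # [Suc i..<b]"
    using assms by (metis le_add_diff_inverse less_imp_le_nat upt_add_eq_append upt_conv_Cons)
  thus ?thesis
    by (simp add: segment_def)
qed

lemma set_segment:
  assumes "\<And>l. a \<le> l \<Longrightarrow> l < b \<Longrightarrow> finite (T l)"
  shows "set (segment p T a b) = {l + p * j |l j. a \<le> l \<and> l < b \<and> j \<in> T l}"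
  using assms by (auto simp: segment_def copies_def) blast

text \<open>The residue mod \<open>p\<close> of an element identifies its player, so different
  players contribute disjoint lists.\<close>

lemma distinct_segment:
  assumes "b \<le> p" "\<And>l. l < b \<Longrightarrow> finite (T l)"
  shows "distinct (segment p T 0 b)"
  using assms
proof (induction b)
  case (Suc b)
  have "segment p T 0 (Suc b) = segment p T 0 b @ copies p b (T b)"
    by (simp add: segment_def)
  moreover have "distinct (copies p b (T b))"
    using Suc.prems by (auto simp: copies_def distinct_map inj_on_def)
  moreover have "x mod p < b" if "x \<in> set (segment p T 0 b)" for x
    using that Suc.prems by (subst (asm) set_segment) auto
  moreover have "x mod p = b" if "x \<in> set (copies p b (T b))" for x
    using that Suc.prems by (auto simp: copies_def)
  ultimately show ?case
    using Suc by (auto simp: Suc_le_eq)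
qed (simp add: segment_def)

lemma segment_in_streams_of:
  assumes "\<And>l. l < p \<Longrightarrow> T l \<subseteq> {..<n}"
  shows "segment p T 0 p \<in> streams_of {..<p * n}"
proof -
  have fin: "finite (T l)" if "l < p" for l
    using assms[OF that] finite_subset by blast
  have "l + p * j < p * n" if "l < p" "j \<in> T l" for l j
  proof -
    have "Suc j \<le> n"
      using assms that by (auto simp: Suc_le_eq)
    hence "p * Suc j \<le> p * n"
      by (intro mult_left_mono) auto
    thus ?thesis
      using that by simp
  qed
  thus ?thesis
    using fin by (auto simp: streams_of_def distinct_segment set_segment)
qed

lemma streams_of_prefix: "xs @ ys \<in> streams_of N \<Longrightarrow> xs \<in> streams_of N"
  by (auto simp: streams_of_def)

section \<open>Counting clock values and memory contents\<close>

lemma length_streams_of: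
  assumes "xs \<in> streams_of N" "finite N"
  shows "length xs \<le> card N"
  using assms by (metis (mono_tags) card_mono distinct_card mem_Collect_eq streams_of_def)

lemma card_bool_lists_length_le: "card {w :: bool list. length w \<le> b} \<le> 2 ^ Suc b"
proof -
  have "card {w :: bool list. length w \<le> b} = (\<Sum>i\<le>b. 2 ^ i)"
    using card_lists_length_le[of "UNIV :: bool set" b] by simp
  also have "\<dots> = 2 ^ Suc b - (1 :: nat)"
    using sum_power2[of "Suc b"] by (simp only: atLeast0LessThan lessThan_Suc_atMost mask_eq_exp_minus_1)
  finally show ?thesis
    by simp
qed

text \<open>
  Player \<open>l\<close> owns the items \<open>\<pi> ` block m l\<close> besides the planted item \<open>\<pi> 0\<close>, and receives a random
  subset of them. In the \<open>i\<close>-th hybrid the planted item is forced into the sets of the players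
  \<open>l > i\<close>, left out of those of the players \<open>l < i\<close>, and treated like any other item by player \<open>i\<close>.
\<close>

definition block :: "nat \<Rightarrow> nat \<Rightarrow> nat set" where
  "block m l = {l * m + 1..l * m + m}"

definition share :: "nat \<Rightarrow> (nat \<Rightarrow> nat) \<Rightarrow> nat \<Rightarrow> nat set \<Rightarrow> nat \<Rightarrow> nat set" where
  "share m \<pi> i W l =
     (if l < i then W \<inter> \<pi> ` block m l
      else if l = i then W \<inter> \<pi> ` insert 0 (block m l)
      else insert (\<pi> 0) (W \<inter> \<pi> ` block m l))"

lemma zero_notin_block: "0 \<notin> block m l"
  by (simp add: block_def)

lemma block_disjoint:
  assumes "l \<noteq> l'"
  shows "block m l \<inter> block m l' = {}"
proof -
  have *: "block m l \<inter> block m l' = {}" if "l < l'" for l l'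
  proof -
    have "Suc l * m \<le> l' * m"
      using that by (intro mult_right_mono) auto
    thus ?thesis
      by (auto simp: block_def)
  qed
  show ?thesis
    using *[of l l'] *[of l' l] assms by (cases "l < l'") (auto simp: Int_commute)
qed

lemma insert_block_subset:
  assumes "l < p"
  shows "insert 0 (block m l) \<subseteq> {..p * m}"
proof -
  have "Suc l * m \<le> p * m"
    using assms by (intro mult_right_mono) auto
  thus ?thesis
    by (auto simp: block_def)
qed

lemma card_insert_block: "card (insert 0 (block m l)) = Suc m"
  by (subst card_insert_disjoint) (auto simp: block_def)

lemma share_subset:
  assumes "\<pi> permutes {..p * m}" "W \<subseteq> {..p * m}"
  shows "share m \<pi> i W l \<subseteq> {..p * m}"
  using assms permutes_in_image[OF assms(1), of 0] by (auto simp: share_def)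

definition hybrid_stream :: "nat \<Rightarrow> nat \<Rightarrow> (nat \<Rightarrow> nat) \<Rightarrow> nat \<Rightarrow> nat set \<Rightarrow> nat list" where
  "hybrid_stream p m \<pi> i W = segment p (share m \<pi> i W) 0 p"

lemma hybrid_stream_in_streams_of:
  assumes "\<pi> permutes {..p * m}" "W \<subseteq> {..p * m}"
  shows "hybrid_stream p m \<pi> i W \<in> streams_of {..<p * Suc (p * m)}"
  unfolding hybrid_stream_def
  using share_subset[OF assms] by (intro segment_in_streams_of) (auto simp: lessThan_Suc_atMost)

text \<open>The transposition exchanges the planted item with another item that player
  \<open>i\<close> may hold. It preserves the pool of player \<open>i\<close> and all other blocks,
  so only the players after \<open>i\<close> notice which item is planted.\<close>

lemma share_swap:
  assumes "inj \<pi>" "q \<in> insert 0 (block m i)"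
  shows "share m (\<pi> \<circ> Transposition.transpose 0 q) i W l =
           (if l < i then W \<inter> \<pi> ` block m l
            else if l = i then W \<inter> \<pi> ` insert 0 (block m l)
            else insert (\<pi> q) (W \<inter> \<pi> ` block m l))"
proof -
  have "(\<pi> \<circ> Transposition.transpose 0 q) ` block m l = \<pi> ` block m l" if "l \<noteq> i"
  proof -
    have "q \<notin> block m l"
      using assms(2) block_disjoint[OF that, of m] zero_notin_block[of m l] by auto
    hence "Transposition.transpose 0 q ` block m l = block m l"
      using zero_notin_block[of m l] by (intro transpose_image_eq) auto
    thus ?thesis
      by (simp only: image_comp[symmetric])
  qed
  moreover have "(\<pi> \<circ> Transposition.transpose 0 q) ` insert 0 (block m i) = \<pi> ` insert 0 (block m i)"
  proof -
    have "Transposition.transpose 0 q ` insert 0 (block m i) = insert 0 (block m i)"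
      using assms(2) by (intro transpose_image_eq) auto
    thus ?thesis
      by (simp only: image_comp[symmetric])
  qed
  ultimately show ?thesis
    by (simp add: share_def del: image_insert)
qed

section \<open>The hybrid argument\<close>

text \<open>Nonemptiness matters: otherwise the empty answer would name every item at once.\<close>

definition names_item :: "nat \<Rightarrow> nat set \<Rightarrow> nat \<Rightarrow> bool" where
  "names_item p S j \<longleftrightarrow> S \<noteq> {} \<and> (\<forall>x\<in>S. x div p = j)"

lemma sum_Pow_Un:
  fixes f :: "'a set \<Rightarrow> 'b :: comm_monoid_add"
  assumes "A \<inter> B = {}"
  shows "(\<Sum>W\<in>Pow (A \<union> B). f W) = (\<Sum>R\<in>Pow A. \<Sum>U\<in>Pow B. f (R \<union> U))"
  unfolding sum.cartesian_product
  by (rule sum.reindex_bij_witness[of _ "\<lambda>(R, U). R \<union> U" "\<lambda>W. (W \<inter> A, W \<inter> B)"])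
     (use assms in \<open>auto simp: Int_Un_distrib[symmetric] intro: arg_cong[where f = f]\<close>)

text \<open>Composition with a fixed transposition permutes the permutations of \<open>J\<close>.
  Hence, under a random \<open>\<pi>\<close>, the planted item may be resampled uniformly from the
  image of \<open>B\<close>.\<close>

lemma sum_permutes_swap:
  fixes G :: "(nat \<Rightarrow> nat) \<Rightarrow> real"
  assumes "B \<subseteq> J" "0 \<in> J"
  shows "card B * (\<Sum>\<pi> | \<pi> permutes J. G \<pi>) =
         (\<Sum>\<pi> | \<pi> permutes J. \<Sum>q\<in>B. G (\<pi> \<circ> Transposition.transpose 0 q))"
proof -
  have "(\<Sum>\<pi> | \<pi> permutes J. G (\<pi> \<circ> Transposition.transpose 0 q)) = (\<Sum>\<pi> | \<pi> permutes J. G \<pi>)" if "q \<in> B" for q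
    using sum_permutations_compose_right[of "Transposition.transpose 0 q" J G] permutes_swap_id[of 0 J q] that assms
    by auto
  thus ?thesis
    by (subst sum.swap) simp
qed

definition hybrid_score :: "nat stream_machine \<Rightarrow> nat \<Rightarrow> nat \<Rightarrow> (nat \<Rightarrow> nat) \<Rightarrow> nat \<Rightarrow> nat set \<Rightarrow> real" where
  "hybrid_score M p m \<pi> i W = of_bool (names_item p (answer M (hybrid_stream p m \<pi> i W)) (\<pi> 0))"

text \<open>An unnormalised success probability of the \<open>i\<close>-th hybrid, given that player
  \<open>i\<close> holds the planted item: \<open>fact (Suc (p * m)) * 2 ^ (p * m)\<close> pairs of
  \<open>\<pi>\<close> and \<open>W\<close> contribute.\<close>

definition hybrid_sum :: "nat stream_machine \<Rightarrow> nat \<Rightarrow> nat \<Rightarrow> nat \<Rightarrow> real" where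
  "hybrid_sum M p m i = (\<Sum>\<pi> | \<pi> permutes {..p * m}. \<Sum>W\<in>Pow {..p * m}.
     if \<pi> 0 \<in> W then hybrid_score M p m \<pi> i W else 0)"

text \<open>Deleting \<open>\<pi> 0\<close> from \<open>W\<close> turns hybrid \<open>Suc i\<close>
  with the item at player \<open>Suc i\<close> into hybrid \<open>i\<close> without it at player
  \<open>i\<close>, and the streams agree. Consecutive hybrids thus differ by a sum signed by
  whether \<open>\<pi> 0 \<in> W\<close>.\<close>

lemma hybrid_sum_Suc:
  "hybrid_sum M p m (Suc i) = (\<Sum>\<pi> | \<pi> permutes {..p * m}. \<Sum>W\<in>Pow {..p * m}.
     if \<pi> 0 \<in> W then 0 else hybrid_score M p m \<pi> i W)"
  unfolding hybrid_sum_def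
proof (rule sum.cong[OF refl])
  fix \<pi> assume "\<pi> \<in> {\<pi>. \<pi> permutes {..p * m}}"
  hence \<pi>: "\<pi> permutes {..p * m}" and inj: "inj \<pi>"
    by (auto simp: permutes_inj)
  define J where "J = {..p * m}"
  have "\<pi> 0 \<in> J"
    using permutes_in_image[OF \<pi>, of 0] by (simp add: J_def)
  have notin: "\<pi> 0 \<notin> \<pi> ` block m l" for l
    using inj zero_notin_block[of m l] by (auto dest: injD)
  have eq: "hybrid_score M p m \<pi> (Suc i) (insert (\<pi> 0) W) = hybrid_score M p m \<pi> i W"
    if "\<pi> 0 \<notin> W" for W
  proof -
    have "share m \<pi> (Suc i) (insert (\<pi> 0) W) = share m \<pi> i W"
      using that notin by (auto simp: share_def fun_eq_iff)
    thus ?thesis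
      by (simp add: hybrid_score_def hybrid_stream_def)
  qed
  have "(\<Sum>W\<in>Pow J. if \<pi> 0 \<in> W then hybrid_score M p m \<pi> (Suc i) W else 0)
      = (\<Sum>W | W \<subseteq> J \<and> \<pi> 0 \<in> W. hybrid_score M p m \<pi> (Suc i) W)"
    by (subst sum.inter_filter[symmetric]) (auto simp: J_def Pow_def)
  also have "\<dots> = (\<Sum>W | W \<subseteq> J \<and> \<pi> 0 \<notin> W. hybrid_score M p m \<pi> i W)"
    using \<open>\<pi> 0 \<in> J\<close> eq[of "_ - {\<pi> 0}", symmetric]
    by (intro sum.reindex_bij_witness[of _ "insert (\<pi> 0)" "\<lambda>W. W - {\<pi> 0}"])
       (auto simp: insert_absorb)
  also have "\<dots> = (\<Sum>W\<in>Pow J. if \<pi> 0 \<notin> W then hybrid_score M p m \<pi> i W else 0)"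
    by (subst sum.inter_filter[symmetric]) (auto simp: J_def Pow_def)
  finally show "(\<Sum>W\<in>Pow {..p * m}. if \<pi> 0 \<in> W then hybrid_score M p m \<pi> (Suc i) W else 0) =
      (\<Sum>W\<in>Pow {..p * m}. if \<pi> 0 \<in> W then 0 else hybrid_score M p m \<pi> i W)"
    unfolding J_def by (simp add: if_distrib cong: if_cong) (auto intro!: sum.cong)
qed

text \<open>Separates the data for the finite class lemma: \<open>R\<close> is fixed,
  \<open>U\<close> is the sign vector of player \<open>i\<close>, and the position \<open>q\<close>
  of the planted item affects only the tail.\<close>

lemma hybrid_stream_swap:
  assumes \<pi>: "inj \<pi>" and q: "q \<in> insert 0 (block m i)" and "i < p"
    and U: "U \<subseteq> \<pi> ` insert 0 (block m i)" and R: "R \<inter> \<pi> ` insert 0 (block m i) = {}"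
  shows "hybrid_stream p m (\<pi> \<circ> Transposition.transpose 0 q) i (R \<union> U) =
           segment p (\<lambda>l. R \<inter> \<pi> ` block m l) 0 i @ copies p i U @
           segment p (\<lambda>l. insert (\<pi> q) (R \<inter> \<pi> ` block m l)) (Suc i) p"
proof -
  have "(R \<union> U) \<inter> \<pi> ` block m l = R \<inter> \<pi> ` block m l" if "l \<noteq> i" for l
  proof -
    have "\<pi> ` insert 0 (block m i) \<inter> \<pi> ` block m l = {}"
      using block_disjoint[OF that, of m] zero_notin_block[of m l] \<pi>
      by (subst image_Int[symmetric]) auto
    thus ?thesis
      using U by blast
  qed
  moreover have "(R \<union> U) \<inter> \<pi> ` insert 0 (block m i) = U"
    using U R by blast
  ultimately show ?thesis
    unfolding hybrid_stream_def segment_split[OF le0 \<open>i < p\<close>]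
    by (intro arg_cong2[where f = append] segment_cong)
       (simp_all add: share_swap[OF \<pi> q] del: image_insert)
qed

lemma sum_of_bool_names_item_le:
  assumes "inj_on \<pi> B" "finite B"
  shows "(\<Sum>q\<in>B. of_bool (names_item p S (\<pi> q)) :: real) \<le> 1"
proof -
  have "card {q\<in>B. names_item p S (\<pi> q)} \<le> Suc 0"
    using assms by (subst card_le_Suc0_iff_eq) (auto simp: names_item_def inj_on_def)
  moreover have "(\<Sum>q\<in>B. of_bool (names_item p S (\<pi> q)) :: real) = card {q\<in>B. names_item p S (\<pi> q)}"
    using assms(2) by (simp add: of_bool_def sum.If_cases Int_def)
  ultimately show ?thesis
    by simp
qed

text \<open>
  The last player cannot tell the planted item from its other items, and an answer names at most
  one item.
\<close>

lemma hybrid_sum_last: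
  assumes "p > 0"
  shows "Suc m * hybrid_sum M p m (p - 1) \<le> fact (Suc (p * m)) * 2 ^ Suc (p * m)"
proof -
  define J where "J = {..p * m}"
  define B where "B = insert 0 (block m (p - 1))"
  have B: "B \<subseteq> J" "card B = Suc m" "0 \<in> J" "finite B"
    using insert_block_subset[of "p - 1" p m] assms card_insert_block[of m "p - 1"]
    by (auto simp: B_def J_def block_def)
  have "Suc m * hybrid_sum M p m (p - 1) = (\<Sum>\<pi> | \<pi> permutes J. \<Sum>q\<in>B. \<Sum>W\<in>Pow J.
      if \<pi> q \<in> W then hybrid_score M p m (\<pi> \<circ> Transposition.transpose 0 q) (p - 1) W else 0)"
    unfolding hybrid_sum_def J_def[symmetric] using B
    by (subst B(2)[symmetric], subst sum_permutes_swap) (auto intro!: sum.cong)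
  also have "\<dots> \<le> (\<Sum>\<pi> | \<pi> permutes J. 2 ^ card J)"
  proof (rule sum_mono)
    fix \<pi> assume "\<pi> \<in> {\<pi>. \<pi> permutes J}"
    hence inj: "inj \<pi>"
      by (auto simp: permutes_inj)
    \<comment> \<open>No player follows \<open>p - 1\<close>, so the stream does not depend on
      \<open>q\<close>.\<close>
    have "hybrid_stream p m (\<pi> \<circ> Transposition.transpose 0 q) (p - 1) W = hybrid_stream p m \<pi> (p - 1) W"
      if "q \<in> B" for q W
      unfolding hybrid_stream_def using that share_swap[OF inj, of q m "p - 1"]
      by (intro segment_cong) (auto simp: B_def share_def simp del: image_insert)
    hence "(\<Sum>q\<in>B. \<Sum>W\<in>Pow J.
        if \<pi> q \<in> W then hybrid_score M p m (\<pi> \<circ> Transposition.transpose 0 q) (p - 1) W else 0) \<le>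
        (\<Sum>q\<in>B. \<Sum>W\<in>Pow J. of_bool (names_item p (answer M (hybrid_stream p m \<pi> (p - 1) W)) (\<pi> q)))"
      by (intro sum_mono) (auto simp: hybrid_score_def)
    also have "\<dots> = (\<Sum>W\<in>Pow J. \<Sum>q\<in>B. of_bool (names_item p (answer M (hybrid_stream p m \<pi> (p - 1) W)) (\<pi> q)))"
      by (rule sum.swap)
    also have "\<dots> \<le> (\<Sum>W\<in>Pow J. 1)"
      using inj B(4) by (intro sum_mono sum_of_bool_names_item_le) (auto intro: inj_on_subset)
    finally show "(\<Sum>q\<in>B. \<Sum>W\<in>Pow J.
        if \<pi> q \<in> W then hybrid_score M p m (\<pi> \<circ> Transposition.transpose 0 q) (p - 1) W else 0) \<le> 2 ^ card J"
      by (simp add: J_def card_Pow)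
  qed
  also have "\<dots> = fact (Suc (p * m)) * 2 ^ Suc (p * m)"
    using card_permutations[of J "Suc (p * m)"] by (simp add: J_def del: fact_Suc power_Suc)
  finally show ?thesis .
qed

text \<open>After resampling the planted item, \<open>sum_signed_le\<close> applies to the set of
  player \<open>i\<close>: the rest of the run sees this set only through the clock and the memory,
  which take at most \<open>K\<close> values together. The parameter \<open>t\<close> stays free
  until the hybrids are added up.\<close>

lemma hybrid_sum_diff_le:
  fixes t K :: real
  assumes mem: "\<And>xs. xs \<in> streams_of {..<p * Suc (p * m)} \<Longrightarrow> length (final_memory M xs) \<le> b"
    and "i < p" and t: "0 < t" "t \<le> 1"
    and K: "K = real ((p * Suc (p * m) + 1) * 2 ^ Suc b)"
  shows "Suc m * (hybrid_sum M p m i - hybrid_sum M p m (Suc i))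
           \<le> fact (Suc (p * m)) * 2 ^ Suc (p * m) * (ln K / t + t * Suc m)"
proof -
  define J where "J = {..p * m}"
  define B where "B = insert 0 (block m i)"
  define C where "C = ln K / t + t * Suc m"
  \<comment> \<open>The clock runs from 0 to the size of the super ground set inclusive, whence the
    \<open>+ 1\<close> in \<open>K\<close>.\<close>
  define S where "S = {..p * Suc (p * m)} \<times> {w :: bool list. length w \<le> b}"
  have B: "B \<subseteq> J" "card B = Suc m" "0 \<in> J" "finite B"
    using insert_block_subset[of i p m] assms card_insert_block[of m i]
    by (auto simp: B_def J_def block_def)
  have "finite {w :: bool list. length w \<le> b}"
    using finite_lists_length_le[of "UNIV :: bool set" b] by simp
  hence S: "finite S" "real (card S) \<le> K"
  proof -
    show "finite S"
      using \<open>finite {w :: bool list. length w \<le> b}\<close> by (simp add: S_def)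
    have "card S \<le> (p * Suc (p * m) + 1) * 2 ^ Suc b"
      unfolding S_def card_cartesian_product
      using card_bool_lists_length_le[of b] by (intro mult_mono) auto
    thus "real (card S) \<le> K"
      unfolding K by (rule of_nat_mono)
  qed
  define h where "h \<pi> q W = hybrid_score M p m (\<pi> \<circ> Transposition.transpose 0 q) i W" for \<pi> q W
  have "Suc m * (hybrid_sum M p m i - hybrid_sum M p m (Suc i)) =
      card B * (\<Sum>\<pi> | \<pi> permutes J. \<Sum>W\<in>Pow J.
        if \<pi> 0 \<in> W then hybrid_score M p m \<pi> i W else - hybrid_score M p m \<pi> i W)"
    unfolding hybrid_sum_Suc B(2) unfolding hybrid_sum_def J_def[symmetric] sum_subtractf[symmetric]
    by (intro arg_cong2[where f = "(*)"] sum.cong) auto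
  also have "\<dots> = (\<Sum>\<pi> | \<pi> permutes J. \<Sum>q\<in>B. \<Sum>W\<in>Pow J. if \<pi> q \<in> W then h \<pi> q W else - h \<pi> q W)"
    unfolding h_def using B by (subst sum_permutes_swap) (auto intro!: sum.cong)
  also have "\<dots> \<le> (\<Sum>\<pi> | \<pi> permutes J. 2 ^ card J * C)"
  proof (rule sum_mono)
    fix \<pi> assume "\<pi> \<in> {\<pi>. \<pi> permutes J}"
    hence \<pi>: "\<pi> permutes J" and inj: "inj \<pi>"
      by (auto simp: permutes_inj)
    define D where "D = \<pi> ` B"
    have D: "D \<subseteq> J" "card D = Suc m" "finite D"
      using \<pi> B inj by (auto simp: D_def card_image permutes_in_image inj_on_subset)
    have "(\<Sum>q\<in>B. \<Sum>W\<in>Pow J. if \<pi> q \<in> W then h \<pi> q W else - h \<pi> q W) =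
          (\<Sum>W\<in>Pow ((J - D) \<union> D). \<Sum>q\<in>B. if \<pi> q \<in> W then h \<pi> q W else - h \<pi> q W)"
      using D by (subst sum.swap) (simp add: Un_absorb2)
    also have "\<dots> = (\<Sum>R\<in>Pow (J - D). \<Sum>U\<in>Pow D. \<Sum>q\<in>B.
        if \<pi> q \<in> R \<union> U then h \<pi> q (R \<union> U) else - h \<pi> q (R \<union> U))"
      by (rule sum_Pow_Un) auto
    also have "\<dots> \<le> (\<Sum>R\<in>Pow (J - D). 2 ^ card D * C)"
    proof (rule sum_mono)
      \<comment> \<open>All random choices outside the pool \<open>D\<close> of player
        \<open>i\<close> are now fixed.\<close>
      fix R assume R: "R \<in> Pow (J - D)"
      define pre where "pre = segment p (\<lambda>l. R \<inter> \<pi> ` block m l) 0 i"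
      define post where "post j = segment p (\<lambda>l. insert j (R \<inter> \<pi> ` block m l)) (Suc i) p" for j
      define g where "g U = run M (pre @ copies p i U) (0, start M)" for U
      \<comment> \<open>The later players, started in state \<open>s\<close> with \<open>j\<close>
        planted; the answer is tested against the same \<open>j\<close>.\<close>
      define a :: "nat \<times> bool list \<Rightarrow> nat \<Rightarrow> real"
        where "a s j = of_bool (names_item p (case_prod (result M) (run M (post j) s)) j)" for s j
      have stream: "hybrid_stream p m (\<pi> \<circ> Transposition.transpose 0 q) i (R \<union> U) =
          (pre @ copies p i U) @ post (\<pi> q)" if "U \<in> Pow D" "q \<in> B" for U q
        unfolding pre_def post_def append_assoc using that R inj \<open>i < p\<close>
        by (intro hybrid_stream_swap) (auto simp: B_def D_def)
      have h_eq: "h \<pi> q (R \<union> U) = a (g U) (\<pi> q)" if "U \<in> Pow D" "q \<in> B" for U q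
        unfolding h_def hybrid_score_def stream[OF that] answer_append a_def g_def by simp
      have g_S: "g ` Pow D \<subseteq> S"
      proof (rule image_subsetI)
        fix U assume U: "U \<in> Pow D"
        \<comment> \<open>The case \<open>q = 0\<close> completes the prefix to a hybrid stream; the
          memory bound then reaches the prefix because streams are closed under prefixes.\<close>
        have "(pre @ copies p i U) @ post (\<pi> 0) \<in> streams_of {..<p * Suc (p * m)}"
          using stream[OF U, of 0] hybrid_stream_in_streams_of[of \<pi> p m "R \<union> U" i] \<pi> U R D
          by (auto simp: B_def J_def)
        hence "pre @ copies p i U \<in> streams_of {..<p * Suc (p * m)}"
          by (rule streams_of_prefix)
        thus "g U \<in> S"
          using mem length_streams_of by (fastforce simp: g_def S_def run_eq_final_memory)
      qed
      have "(\<Sum>U\<in>Pow D. \<Sum>q\<in>B. if \<pi> q \<in> R \<union> U then h \<pi> q (R \<union> U) else - h \<pi> q (R \<union> U)) =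
            (\<Sum>U\<in>Pow D. \<Sum>q\<in>B. if \<pi> q \<in> U then a (g U) (\<pi> q) else - a (g U) (\<pi> q))"
      proof (intro sum.cong refl)
        fix U q assume Uq: "U \<in> Pow D" "q \<in> B"
        hence "\<pi> q \<notin> R"
          using R by (auto simp: D_def)
        thus "(if \<pi> q \<in> R \<union> U then h \<pi> q (R \<union> U) else - h \<pi> q (R \<union> U)) =
              (if \<pi> q \<in> U then a (g U) (\<pi> q) else - a (g U) (\<pi> q))"
          using h_eq[OF Uq] by simp
      qed
      also have "\<dots> = (\<Sum>U\<in>Pow D. \<Sum>j\<in>D. if j \<in> U then a (g U) j else - a (g U) j)"
        using inj_on_subset[OF inj subset_UNIV, of B] by (simp add: D_def sum.reindex)
      also have "\<dots> \<le> 2 ^ card D * (ln K / t + t * card D)"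
        using D(3) S(1) g_S S(2) t by (rule sum_signed_le) (simp add: a_def)
      finally show "(\<Sum>U\<in>Pow D. \<Sum>q\<in>B. if \<pi> q \<in> R \<union> U then h \<pi> q (R \<union> U) else - h \<pi> q (R \<union> U))
          \<le> 2 ^ card D * C"
        by (simp add: C_def D(2))
    qed
    also have "\<dots> = 2 ^ (card (J - D) + card D) * C"
      by (simp add: J_def card_Pow power_add)
    also have "card (J - D) + card D = card J"
      using D card_mono[of J D] by (simp add: card_Diff_subset J_def)
    finally show "(\<Sum>q\<in>B. \<Sum>W\<in>Pow J. if \<pi> q \<in> W then h \<pi> q W else - h \<pi> q W) \<le> 2 ^ card J * C" .
  qed
  also have "\<dots> = fact (Suc (p * m)) * 2 ^ Suc (p * m) * C"
    using card_permutations[of J "Suc (p * m)"] by (simp add: J_def del: fact_Suc power_Suc)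
  finally show ?thesis
    unfolding C_def .
qed

text \<open>Telescoping over \<open>p - 1\<close> steps of \<open>hybrid_sum_diff_le\<close>; the
  summand 1 is the guessing bound of \<open>hybrid_sum_last\<close>.\<close>

lemma hybrid_sum_0_le:
  fixes t K :: real
  assumes mem: "\<And>xs. xs \<in> streams_of {..<p * Suc (p * m)} \<Longrightarrow> length (final_memory M xs) \<le> b"
    and "p > 0" and t: "0 < t" "t \<le> 1"
    and K: "K = real ((p * Suc (p * m) + 1) * 2 ^ Suc b)"
  shows "Suc m * hybrid_sum M p m 0
           \<le> fact (Suc (p * m)) * 2 ^ Suc (p * m) * (1 + (real p - 1) * (ln K / t + t * Suc m))"
proof -
  define F :: real where "F = fact (Suc (p * m)) * 2 ^ Suc (p * m)"
  define C where "C = ln K / t + t * Suc m"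
  have "Suc m * hybrid_sum M p m 0 \<le> Suc m * hybrid_sum M p m i + i * (F * C)" if "i < p" for i
    using that
  proof (induction i)
    case (Suc i)
    have "Suc m * (hybrid_sum M p m i - hybrid_sum M p m (Suc i)) \<le> F * C"
      unfolding F_def C_def using Suc.prems t by (intro hybrid_sum_diff_le[OF mem _ _ _ K]) auto
    thus ?case
      using Suc by (simp add: algebra_simps)
  qed simp
  from this[of "p - 1"] have "Suc m * hybrid_sum M p m 0 \<le> F + (p - 1) * (F * C)"
    using hybrid_sum_last[OF \<open>p > 0\<close>, of m M] \<open>p > 0\<close> unfolding F_def by linarith
  thus ?thesis
    using \<open>p > 0\<close> unfolding F_def[symmetric] C_def[symmetric]
    by (simp add: algebra_simps Suc_le_eq)
qed

section \<open>From approximate solutions to the memory bound\<close>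

text \<open>The \<open>p\<close> copies of the planted item push the optimum above
  \<open>\<alpha>\<close>, so the answer has at least two elements. These are copies of one item at
  two different players, and only the planted item is shared.\<close>

lemma names_planted_item_if_approx_solution:
  assumes r: "\<And>j j' a b. j < Suc (p * m) \<Longrightarrow> j' < Suc (p * m) \<Longrightarrow> j \<noteq> j' \<Longrightarrow> a < p \<Longrightarrow> b < p \<Longrightarrow>
                \<exists>l<k. (a + r j l) mod p = (b + r j' l) mod p"
    and \<alpha>: "1 \<le> \<alpha>" "\<alpha> < real p"
    and \<pi>: "\<pi> permutes {..p * m}" and W: "W \<subseteq> {..p * m}" "\<pi> 0 \<in> W"
    and S: "approx_solution \<alpha> k (\<lambda>l. transversals {..<p * Suc (p * m)} (colour p r l))
              (\<lambda>S. real (card S)) (set (hybrid_stream p m \<pi> 0 W)) S"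
  shows "names_item p S (\<pi> 0)"
proof -
  define N where "N = {..<p * Suc (p * m)}"
  define I where "I = (\<lambda>l. transversals N (colour p r l))"
  define E where "E = set (hybrid_stream p m \<pi> 0 W)"
  have "p > 0"
    using \<alpha> by (cases p) auto
  \<comment> \<open>Player 0 is the one whose planted item is not forced; here it comes from
    \<open>\<pi> 0 \<in> W\<close>, so all players hold it.\<close>
  have share: "share m \<pi> 0 W l = insert (\<pi> 0) (W \<inter> \<pi> ` block m l)" for l
    using W by (auto simp: share_def)
  have E: "E = {l + p * j |l j. l < p \<and> j \<in> insert (\<pi> 0) (W \<inter> \<pi> ` block m l)}"
    unfolding E_def hybrid_stream_def by (subst set_segment) (auto simp: share block_def)
  have E_sub: "E \<subseteq> N"
    using hybrid_stream_in_streams_of[OF \<pi> W(1), of 0] by (auto simp: E_def N_def streams_of_def)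
  define T where "T = (\<lambda>l. l + p * \<pi> 0) ` {..<p}"
  have T: "T \<subseteq> E"
    by (auto simp: T_def E)
  have "inj_on (colour p r l) T" for l
    using \<open>p > 0\<close> by (intro inj_on_colour[of _ _ "\<pi> 0"]) (auto simp: T_def)
  hence "T \<in> common_indep k I E"
    using T E_sub by (auto simp: common_indep_def I_def transversals_def)
  moreover have "finite (common_indep k I E)"
    by (rule finite_subset[of _ "Pow E"]) (auto simp: common_indep_def E_def)
  ultimately have "real (card T) \<le> opt k I (\<lambda>S. real (card S)) E"
    unfolding opt_def by (intro Max_ge) auto
  moreover have "card T = p"
    unfolding T_def by (subst card_image) (auto simp: inj_on_def)
  ultimately have "1 < opt k I (\<lambda>S. real (card S)) E / \<alpha>"
    using \<alpha> by simp
  with S have "1 < card S" and indep: "S \<in> common_indep k I E"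
    by (auto simp: approx_solution_def I_def E_def N_def)
  have S_sub: "S \<subseteq> E" and inj: "l < k \<Longrightarrow> inj_on (colour p r l) S" for l
    using indep by (auto simp: common_indep_def I_def transversals_def)
  have same: "x div p = y div p" if "x \<in> S" "y \<in> S" for x y
    using r inj that S_sub E_sub
    by (intro same_item_if_inj_on_colours[of "Suc (p * m)" p k r S]) (auto simp: N_def)
  have member: "x div p = \<pi> 0 \<or> x div p \<in> \<pi> ` block m (x mod p)" if "x \<in> S" for x
    using that S_sub by (auto simp: E)
  obtain x y where xy: "x \<in> S" "y \<in> S" "x \<noteq> y"
    using \<open>1 < card S\<close> by (metis card_le_Suc0_iff_eq card.infinite One_nat_def linorder_not_less
        not_less_zero)
  hence "x mod p \<noteq> y mod p"
    using same by (metis div_mult_mod_eq)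
  hence "\<pi> ` block m (x mod p) \<inter> \<pi> ` block m (y mod p) = {}"
    using permutes_inj[OF \<pi>] block_disjoint[of "x mod p" "y mod p" m]
    by (subst image_Int[symmetric]) auto
  hence "x div p = \<pi> 0"
    using member[OF xy(1)] member[OF xy(2)] same[OF xy(1,2)] by auto
  hence "z div p = \<pi> 0" if "z \<in> S" for z
    using same[OF that xy(1)] by simp
  thus ?thesis
    using xy(1) by (auto simp: names_item_def)
qed

lemma card_subsets_containing:
  assumes "finite J" "j \<in> J"
  shows "2 * card {W. W \<subseteq> J \<and> j \<in> W} = 2 ^ card J"
proof -
  have "{W. W \<subseteq> J \<and> j \<in> W} = insert j ` Pow (J - {j})"
  proof (intro subset_antisym subsetI)
    fix W assume "W \<in> {W. W \<subseteq> J \<and> j \<in> W}"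
    thus "W \<in> insert j ` Pow (J - {j})"
      by (intro image_eqI[of _ _ "W - {j}"]) auto
  qed (use assms in auto)
  moreover have "inj_on (insert j) (Pow (J - {j}))"
    by (rule inj_onI) auto
  ultimately have "card {W. W \<subseteq> J \<and> j \<in> W} = 2 ^ card (J - {j})"
    using assms by (simp add: card_image card_Pow)
  moreover have "card J = Suc (card (J - {j}))"
    using assms by (metis card.remove)
  ultimately show ?thesis
    by simp
qed

text \<open>The averaging step of Yao's principle, by linearity of expectation. The factor 2 arises
  because half of the sets \<open>W\<close> contain \<open>\<pi> 0\<close>.\<close>

lemma expectation_hybrid_sum_ge:
  fixes A :: "nat stream_algorithm"
  assumes prob: "\<And>\<pi> W. \<pi> permutes {..p * m} \<Longrightarrow> W \<subseteq> {..p * m} \<Longrightarrow> \<pi> 0 \<in> W \<Longrightarrow>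
      c \<le> measure_pmf.prob A {M. names_item p (answer M (hybrid_stream p m \<pi> 0 W)) (\<pi> 0)}"
  shows "fact (Suc (p * m)) * 2 ^ Suc (p * m) * c
           \<le> 2 * measure_pmf.expectation A (\<lambda>M. hybrid_sum M p m 0)"
proof -
  define J where "J = {..p * m}"
  define F where "F \<pi> W = {M. names_item p (answer M (hybrid_stream p m \<pi> 0 W)) (\<pi> 0)}" for \<pi> W
  have "hybrid_sum M p m 0 = (\<Sum>\<pi> | \<pi> permutes J. \<Sum>W | W \<subseteq> J \<and> \<pi> 0 \<in> W. indicator (F \<pi> W) M)" for M
    unfolding hybrid_sum_def J_def[symmetric]
  proof (rule sum.cong[OF refl])
    fix \<pi>
    have "(\<Sum>W\<in>Pow J. if \<pi> 0 \<in> W then hybrid_score M p m \<pi> 0 W else 0) =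
          (\<Sum>W | W \<in> Pow J \<and> \<pi> 0 \<in> W. hybrid_score M p m \<pi> 0 W)"
      by (rule sum.inter_filter[symmetric]) (simp add: J_def)
    thus "(\<Sum>W\<in>Pow J. if \<pi> 0 \<in> W then hybrid_score M p m \<pi> 0 W else 0) =
          (\<Sum>W | W \<subseteq> J \<and> \<pi> 0 \<in> W. indicator (F \<pi> W) M)"
      by (simp add: hybrid_score_def F_def indicator_def)
  qed
  hence "measure_pmf.expectation A (\<lambda>M. hybrid_sum M p m 0) =
      (\<Sum>\<pi> | \<pi> permutes J. \<Sum>W | W \<subseteq> J \<and> \<pi> 0 \<in> W. measure_pmf.prob A (F \<pi> W))"
    by (simp add: Bochner_Integration.integral_sum measure_pmf.integrable_const_bound[of _ 1])
  also have "\<dots> \<ge> (\<Sum>\<pi> | \<pi> permutes J. \<Sum>W | W \<subseteq> J \<and> \<pi> 0 \<in> W. c)"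
    using prob by (intro sum_mono) (auto simp: J_def F_def)
  also have "(\<Sum>\<pi> | \<pi> permutes J. \<Sum>W | W \<subseteq> J \<and> \<pi> 0 \<in> W. c) = (\<Sum>\<pi> | \<pi> permutes J. 2 ^ card J / 2 * c)"
  proof (rule sum.cong[OF refl])
    fix \<pi> assume "\<pi> \<in> {\<pi>. \<pi> permutes J}"
    hence "\<pi> 0 \<in> J"
      using permutes_in_image[of \<pi> J 0] by (simp add: J_def)
    hence "2 * card {W. W \<subseteq> J \<and> \<pi> 0 \<in> W} = 2 ^ card J"
      by (intro card_subsets_containing) (auto simp: J_def)
    hence "2 * real (card {W. W \<subseteq> J \<and> \<pi> 0 \<in> W}) = 2 ^ card J"
      by (metis of_nat_mult of_nat_numeral of_nat_power)
    thus "(\<Sum>W | W \<subseteq> J \<and> \<pi> 0 \<in> W. c) = 2 ^ card J / 2 * c"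
      by simp
  qed
  also have "\<dots> = fact (Suc (p * m)) * 2 ^ Suc (p * m) * c / 2"
    using card_permutations[of J "Suc (p * m)"] by (simp add: J_def del: fact_Suc power_Suc)
  finally show ?thesis
    by simp
qed

lemma memory_lower_bound:
  fixes A :: "nat stream_algorithm"
  assumes r: "\<And>j j' a b. j < Suc (p * m) \<Longrightarrow> j' < Suc (p * m) \<Longrightarrow> j \<noteq> j' \<Longrightarrow> a < p \<Longrightarrow> b < p \<Longrightarrow>
                \<exists>l<k. (a + r j l) mod p = (b + r j' l) mod p"
    and \<alpha>: "1 \<le> \<alpha>" "\<alpha> < real p"
    and N: "N = {..<p * Suc (p * m)}"
    and A: "finds_approx_solution A \<alpha> k N (\<lambda>l. transversals N (colour p r l)) (\<lambda>S. real (card S))"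
    and b: "uses_memory_at_most A N b"
  shows "real (Suc m) \<le> 4 + 48 * (real p)\<^sup>2 * (ln (real (p * Suc (p * m) + 1)) + b + 1)"
proof -
  have "p > 0"
    using \<alpha> by (cases p) auto
  \<comment> \<open>With this choice the terms \<open>t * Suc m\<close> of all hybrids add up to at
    most \<open>Suc m / 12\<close>, a quarter of the left side \<open>Suc m / 3\<close>, and can be
    absorbed there.\<close>
  define t where "t = 1 / (12 * real p)"
  have t: "0 < t" "t \<le> 1"
    using \<open>p > 0\<close> by (auto simp: t_def)
  define K where "K = real ((p * Suc (p * m) + 1) * 2 ^ Suc b)"
  define F :: real where "F = fact (Suc (p * m)) * 2 ^ Suc (p * m)"
  define Y where "Y = 1 + (real p - 1) * (ln K / t + t * Suc m)"
  define B where "B = F * Y / Suc m"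
  have "F > 0"
    by (simp add: F_def del: fact_Suc)
  have le: "hybrid_sum M p m 0 \<le> B" if "M \<in> set_pmf A" for M
  proof -
    have "length (final_memory M xs) \<le> b" if "xs \<in> streams_of {..<p * Suc (p * m)}" for xs
      using b that \<open>M \<in> set_pmf A\<close> by (auto simp: uses_memory_at_most_def N)
    from hybrid_sum_0_le[OF this \<open>p > 0\<close> t K_def] show ?thesis
      unfolding B_def Y_def F_def[symmetric] by (subst pos_le_divide_eq) (auto simp: mult.commute)
  qed
  have nonneg: "0 \<le> hybrid_sum M p m 0" for M
    unfolding hybrid_sum_def hybrid_score_def by (intro sum_nonneg) auto
  have "2 / 3 \<le> measure_pmf.prob A {M. names_item p (answer M (hybrid_stream p m \<pi> 0 W)) (\<pi> 0)}"
    if \<pi>W: "\<pi> permutes {..p * m}" "W \<subseteq> {..p * m}" "\<pi> 0 \<in> W" for \<pi> W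
  proof -
    have "2 / 3 \<le> measure_pmf.prob A {M. approx_solution \<alpha> k (\<lambda>l. transversals N (colour p r l))
        (\<lambda>S. real (card S)) (set (hybrid_stream p m \<pi> 0 W)) (answer M (hybrid_stream p m \<pi> 0 W))}"
      using A hybrid_stream_in_streams_of[OF \<pi>W(1,2), of 0] by (simp add: finds_approx_solution_def N)
    also have "\<dots> \<le> measure_pmf.prob A {M. names_item p (answer M (hybrid_stream p m \<pi> 0 W)) (\<pi> 0)}"
      using names_planted_item_if_approx_solution[OF r \<alpha> \<pi>W]
      by (intro measure_pmf.finite_measure_mono) (auto simp: N)
    finally show ?thesis .
  qed
  hence "F * (2 / 3) \<le> 2 * measure_pmf.expectation A (\<lambda>M. hybrid_sum M p m 0)"
    unfolding F_def by (rule expectation_hybrid_sum_ge)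
  also have "measure_pmf.expectation A (\<lambda>M. hybrid_sum M p m 0) \<le> B"
  proof (rule measure_pmf.integral_le_const)
    show "integrable (measure_pmf A) (\<lambda>M. hybrid_sum M p m 0)"
      using le nonneg by (intro measure_pmf.integrable_const_bound[of _ B]) (auto simp: AE_measure_pmf_iff)
    show "AE M in measure_pmf A. hybrid_sum M p m 0 \<le> B"
      using le by (simp add: AE_measure_pmf_iff)
  qed
  finally have "F * (Suc m / 3) \<le> F * Y"
    by (simp add: B_def field_simps)
  hence "Suc m / 3 \<le> 1 + (real p - 1) * (ln K / t + t * Suc m)"
    using \<open>F > 0\<close> by (simp only: mult_le_cancel_left_pos Y_def)
  also have "\<dots> \<le> 1 + p * (ln K / t + t * Suc m)"
  proof -
    have "0 < (p * Suc (p * m) + 1) * 2 ^ Suc b"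
      by simp
    hence "K \<ge> 1"
      unfolding K_def by linarith
    hence "ln K / t + t * Suc m \<ge> 0"
      using t by simp
    hence "(real p - 1) * (ln K / t + t * Suc m) \<le> p * (ln K / t + t * Suc m)"
      by (intro mult_right_mono) auto
    thus ?thesis
      by simp
  qed
  also have "\<dots> = 1 + 12 * (real p)\<^sup>2 * ln K + Suc m / 12"
    using \<open>p > 0\<close> by (simp add: t_def field_simps power2_eq_square)
  finally have "Suc m \<le> 4 + 48 * (real p)\<^sup>2 * ln K"
    by (simp add: field_simps)
  also have "ln K \<le> ln (real (p * Suc (p * m) + 1)) + b + 1"
  proof -
    have "ln K = ln (real (p * Suc (p * m) + 1)) + ln (2 ^ Suc b)"
      unfolding K_def of_nat_mult of_nat_power of_nat_numeral by (intro ln_mult_pos) (auto intro: add_pos_nonneg)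
    also have "ln (2 ^ Suc b :: real) = Suc b * ln 2"
      by (rule ln_realpow)
    also have "\<dots> \<le> real (Suc b) * 1"
      using ln_2_less_1 by (intro mult_left_mono) auto
    finally show ?thesis
      by simp
  qed
  hence "4 + 48 * (real p)\<^sup>2 * ln K \<le> 4 + 48 * (real p)\<^sup>2 * (ln (real (p * Suc (p * m) + 1)) + b + 1)"
    by (intro add_left_mono mult_left_mono) auto
  finally show ?thesis .
qed

section \<open>Choice of parameters\<close>

text \<open>Of the four factors \<open>X\<close> below \<open>E\<close>, one is kept for the claim.
  The other three are at least \<open>k ^ 12\<close>, which pays for \<open>p ^ 3\<close> and for
  all lower order terms.\<close>

lemma numeric_bound:
  fixes k p m b :: nat and X :: real
  assumes k: "2 \<le> k" and p: "0 < p" "p \<le> k" and X: "real k ^ 4 \<le> X"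
    and E: "X ^ 4 \<le> E" "E / real p ^ 3 - 1 \<le> real (Suc m)"
    and L: "L \<le> real k"
    and b: "real (Suc m) \<le> 4 + 48 * (real p)\<^sup>2 * (L + b + 1)"
  shows "X / (real k)\<^sup>2 / 400 \<le> real b"
proof -
  define x where "x = real k"
  have x: "2 \<le> x" "real p \<le> x" "x ^ 4 \<le> X"
    using k p X by (auto simp: x_def)
  have "X > 0"
    using x by (intro less_le_trans[OF _ x(3)]) auto
  have "X * x ^ 9 \<le> E / real p ^ 3"
  proof -
    have "X * x ^ 9 * real p ^ 3 \<le> X * x ^ 9 * x ^ 3"
      using x \<open>X > 0\<close> by (intro mult_left_mono power_mono) auto
    also have "\<dots> = X * (x ^ 4) ^ 3"
      by (simp add: power_mult[symmetric] power_add[symmetric])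
    also have "\<dots> \<le> X * X ^ 3"
      using x \<open>X > 0\<close> by (intro mult_left_mono power_mono) auto
    also have "\<dots> \<le> E"
      using E(1) by (simp add: power4_eq_xxxx power3_eq_cube mult.assoc)
    finally show ?thesis
      using p by (simp add: field_simps)
  qed
  also have "\<dots> \<le> 5 + 48 * (real p)\<^sup>2 * (L + b + 1)"
    using E(2) b by linarith
  also have "\<dots> \<le> 5 + 48 * x\<^sup>2 * (x + b + 1)"
  proof -
    have "(real p)\<^sup>2 * (L + b + 1) \<le> (real p)\<^sup>2 * (x + b + 1)"
      using L by (intro mult_left_mono) (auto simp: x_def)
    also have "\<dots> \<le> x\<^sup>2 * (x + b + 1)"
      using x by (intro mult_right_mono power_mono) auto
    finally show ?thesis
      by simp
  qed
  also have "\<dots> \<le> 48 * x\<^sup>2 * b + 77 * x ^ 3"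
  proof -
    have "2 * x\<^sup>2 \<le> x * x\<^sup>2" "2 ^ 3 \<le> x ^ 3"
      using x by (intro mult_right_mono power_mono; simp)+
    thus ?thesis
      by (simp add: algebra_simps power2_eq_square power3_eq_cube)
  qed
  finally have "X * x ^ 9 \<le> 48 * x\<^sup>2 * b + 77 * x ^ 3" .
  moreover have "77 * x ^ 3 \<le> 77 / 1024 * (X * x ^ 9)"
  proof -
    have "1024 * x ^ 3 \<le> x ^ 10 * x ^ 3"
      using power_mono[of 2 x 10] x by (intro mult_right_mono) auto
    also have "\<dots> = x ^ 4 * x ^ 9"
      by (simp add: power_add[symmetric])
    also have "\<dots> \<le> X * x ^ 9"
      using x by (intro mult_right_mono) auto
    finally show ?thesis
      by simp
  qed
  moreover have "0 \<le> x\<^sup>2 * b" "0 \<le> X * x ^ 9"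
    using x \<open>X > 0\<close> by auto
  \<comment> \<open>The constant is generous: 48 divided by \<open>1 - 77 / 1024\<close> is below
    52.\<close>
  ultimately have "X * x ^ 9 \<le> 400 * (x\<^sup>2 * b)"
    by linarith
  moreover have "X * 1 \<le> X * x ^ 9"
    using x \<open>X > 0\<close> one_le_power[of x 9] by (intro mult_left_mono) auto
  ultimately have "X \<le> 400 * (x\<^sup>2 * b)"
    by linarith
  thus ?thesis
    using x by (simp add: x_def[symmetric] field_simps)
qed

lemma hard_instance:
  fixes k :: nat and \<alpha> :: real
  assumes k: "2 \<le> k" and \<alpha>: "1 \<le> \<alpha>" "\<alpha> \<le> real k / (32 * ln (real k))"
  shows "\<exists>(N :: nat set) (I :: nat \<Rightarrow> nat set set).
         smkm_instance k N I (\<lambda>S. real (card S)) \<and>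
         (\<forall>i<k. partition_matroid N (I i)) \<and>
         real (common_rank k I N) \<le> 2 * \<alpha> \<and>
         real (common_rank k I N) \<le> 2 * (real k / ln (real k)) \<and>
         real (card N) \<le> exp (2 * real k / \<alpha>) \<and>
         (\<forall>(A :: nat stream_algorithm) (b :: nat).
            finds_approx_solution A \<alpha> k N I (\<lambda>S. real (card S)) \<and> uses_memory_at_most A N b
            \<longrightarrow> real b \<ge> 1 / 400 * (exp (real k / (8 * \<alpha>)) / (real k)^2))"
proof -
  \<comment> \<open>The least integer above \<open>\<alpha>\<close>; it is at most
    \<open>2 * \<alpha>\<close> because \<open>\<alpha> \<ge> 1\<close>.\<close>
  define p where "p = Suc (nat \<lfloor>\<alpha>\<rfloor>)"
  have p: "\<alpha> < real p" "real p \<le> 2 * \<alpha>"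
    using \<alpha>(1) unfolding p_def by linarith+
  hence "2 \<le> p"
    using \<alpha>(1) by linarith
  have ln_k: "1 / 2 \<le> ln (real k)"
  proof -
    have "1 / 2 \<le> ln (2 :: real)"
      using ln2_ge_two_thirds by simp
    also have "\<dots> \<le> ln (real k)"
      using k by simp
    finally show ?thesis .
  qed
  have \<alpha>k: "\<alpha> * (32 * ln (real k)) \<le> k"
    using \<alpha>(2) ln_k by (simp add: pos_le_divide_eq)
  have "\<alpha> * 16 \<le> \<alpha> * (32 * ln (real k))"
    using \<alpha>(1) ln_k by (intro mult_left_mono) auto
  hence "p \<le> k"
    using \<alpha>k \<alpha>(1) p by linarith
  define E where "E = exp (real k / real p)"
  define X where "X = exp (real k / (8 * \<alpha>))"
  have "real k ^ 4 = exp (4 * ln (real k))"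
    using k by (simp add: exp_of_nat_mult[of 4, simplified])
  \<comment> \<open>The hypothesis on \<open>\<alpha>\<close> says precisely that
    \<open>k / (8 * \<alpha>) \<ge> 4 * ln k\<close>.\<close>
  also have "\<dots> \<le> X"
    using \<alpha>k \<alpha>(1) by (simp add: X_def pos_le_divide_eq mult_ac)
  finally have X: "real k ^ 4 \<le> X" .
  have "X ^ 4 = exp (real k / (2 * \<alpha>))"
    unfolding X_def by (simp add: exp_of_nat_mult[symmetric])
  also have "\<dots> \<le> E"
    unfolding E_def using p \<alpha>(1) by (simp add: frac_le)
  finally have XE: "X ^ 4 \<le> E" .
  have "real p ^ 3 \<le> E"
  proof -
    have "real p ^ 3 \<le> real k ^ 16"
      using \<open>p \<le> k\<close> k by (intro order_trans[OF power_mono[of "real p" "real k" 3] power_increasing]) auto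
    also have "\<dots> = (real k ^ 4) ^ 4"
      by simp
    also have "\<dots> \<le> X ^ 4"
      using X by (intro power_mono) auto
    finally show ?thesis
      using XE by simp
  qed
  \<comment> \<open>The largest \<open>m\<close> with \<open>p ^ 3 * Suc m \<le> E\<close>. The
    quotient is at least 1, so the truncated subtraction is exact.\<close>
  define m where "m = nat \<lfloor>E / real p ^ 3\<rfloor> - 1"
  have "1 \<le> E / real p ^ 3"
    using \<open>real p ^ 3 \<le> E\<close> \<open>2 \<le> p\<close> by simp
  hence "1 \<le> \<lfloor>E / real p ^ 3\<rfloor>"
    by simp
  hence m: "real (Suc m) = \<lfloor>E / real p ^ 3\<rfloor>"
    unfolding m_def by simp
  hence m_ge: "E / real p ^ 3 - 1 \<le> real (Suc m)" and "real (Suc m) \<le> E / real p ^ 3"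
    by linarith+
  hence "real (Suc m) * real p ^ 3 \<le> E"
    using \<open>2 \<le> p\<close> by (simp add: pos_le_divide_eq del: of_nat_Suc)
  hence m_le: "real (p ^ 3 * Suc m) \<le> E"
    by (simp only: of_nat_mult of_nat_power mult.commute)
  \<comment> \<open>One block of \<open>m\<close> items for each of the \<open>p\<close> players,
    and the planted item.\<close>
  define n where "n = Suc (p * m)"
  have "n * p\<^sup>2 = p ^ 3 * m + p\<^sup>2"
    by (simp add: n_def algebra_simps power2_eq_square power3_eq_cube)
  also have "\<dots> < p ^ 3 * Suc m"
    using \<open>2 \<le> p\<close> by (simp add: power2_eq_square power3_eq_cube)
  finally have n_less: "n * p\<^sup>2 < p ^ 3 * Suc m" .
  have np: "p * n + 1 \<le> p ^ 3 * Suc m"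
  proof -
    have "p * n \<le> n * p\<^sup>2"
      using \<open>2 \<le> p\<close> by (simp add: power2_eq_square)
    thus ?thesis
      using n_less by linarith
  qed
  have "real (n * p\<^sup>2) < exp (real k / real p)"
    using n_less m_le unfolding E_def by (smt (verit) of_nat_less_iff)
  from exists_colliding_code_exp[OF \<open>2 \<le> p\<close> this] obtain r :: "nat \<Rightarrow> nat \<Rightarrow> nat"
    where r: "\<And>j j' a b. j < n \<Longrightarrow> j' < n \<Longrightarrow> j \<noteq> j' \<Longrightarrow> a < p \<Longrightarrow> b < p \<Longrightarrow>
                \<exists>l<k. (a + r j l) mod p = (b + r j' l) mod p"
    by blast
  define N where "N = {..<p * n}"
  define I where "I = (\<lambda>l. transversals N (colour p r l))"
  have "finite N"
    by (simp add: N_def)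
  have "common_rank k I N \<le> p"
  proof -
    have "finite (common_indep k I N)"
      by (rule finite_subset[of _ "Pow N"]) (auto simp: common_indep_def \<open>finite N\<close>)
    moreover have "{} \<in> common_indep k I N"
      by (simp add: common_indep_def I_def transversals_def)
    ultimately show ?thesis
      using card_common_indep_colour_le[of k p _ N r N] k \<open>2 \<le> p\<close>
      unfolding common_rank_def I_def by (subst Max_le_iff) auto
  qed
  hence rank: "real (common_rank k I N) \<le> 2 * \<alpha>"
    using p by linarith
  also have "\<dots> \<le> 2 * (real k / ln (real k))"
    using \<alpha>k \<alpha>(1) ln_k mult_nonneg_nonneg[of \<alpha> "ln (real k)"] by (simp add: pos_le_divide_eq)
  finally have rank': "real (common_rank k I N) \<le> 2 * (real k / ln (real k))" .
  have cardN: "real (card N) + 1 \<le> E"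
    using np m_le unfolding N_def by (smt (verit) card_lessThan of_nat_1 of_nat_add of_nat_mono)
  have "E \<le> exp (2 * real k / \<alpha>)"
    unfolding E_def using p \<alpha>(1) by (simp add: frac_le)
  hence cardN': "real (card N) \<le> exp (2 * real k / \<alpha>)"
    using cardN by linarith
  \<comment> \<open>The clock contributes only \<open>ln E = k / p\<close> to the logarithm of the
    number of states.\<close>
  have L: "ln (real (p * n + 1)) \<le> real k"
  proof -
    have "ln (real (p * n + 1)) \<le> ln E"
      using cardN by (intro ln_mono) (auto simp: N_def add.commute add_pos_nonneg)
    also have "\<dots> \<le> real k"
      using \<open>2 \<le> p\<close> by (simp add: E_def divide_le_eq mult_le_cancel_left1)
    finally show ?thesis .
  qed
  have bound: "real b \<ge> 1 / 400 * (X / (real k)^2)"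
    if A: "finds_approx_solution A \<alpha> k N I (\<lambda>S. real (card S))" "uses_memory_at_most A N b"
    for A :: "nat stream_algorithm" and b
  proof -
    have "real (Suc m) \<le> 4 + 48 * (real p)\<^sup>2 * (ln (real (p * n + 1)) + b + 1)"
      using memory_lower_bound[OF r[unfolded n_def] \<alpha>(1) p(1) N_def[unfolded n_def] A(1)[unfolded I_def] A(2)]
      unfolding n_def by simp
    from numeric_bound[OF k _ \<open>p \<le> k\<close> X XE m_ge L this] \<open>2 \<le> p\<close> show ?thesis
      by simp
  qed
  have "smkm_instance k N I (\<lambda>S. real (card S))"
    using k \<open>finite N\<close> unfolding smkm_instance_def I_def
    by (simp add: matroid_transversals submodular_on_card)
  moreover have "\<forall>i<k. partition_matroid N (I i)"
    using \<open>finite N\<close> by (simp add: I_def partition_matroid_transversals)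
  ultimately show ?thesis
    using rank rank' cardN' bound unfolding X_def by blast
qed

theorem theorem1p2:
  shows "\<exists>c C :: real. 0 < c \<and> 0 < C \<and>
    (\<forall>(k::nat) (\<alpha>::real). 2 \<le> k \<and> 1 \<le> \<alpha> \<and> \<alpha> \<le> real k / (32 * ln (real k)) \<longrightarrow>
      (\<exists>(N :: nat set) (I :: nat \<Rightarrow> nat set set).
         smkm_instance k N I (\<lambda>S. real (card S)) \<and>
         (\<forall>i<k. partition_matroid N (I i)) \<and>
         real (common_rank k I N) \<le> C * \<alpha> \<and>
         real (common_rank k I N) \<le> C * (real k / ln (real k)) \<and>
         real (card N) \<le> exp (C * real k / \<alpha>) \<and>
         (\<forall>(A :: nat stream_algorithm) (b :: nat).
            finds_approx_solution A \<alpha> k N I (\<lambda>S. real (card S)) \<and> uses_memory_at_most A N b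
            \<longrightarrow> real b \<ge> c * (exp (real k / (8 * \<alpha>)) / (real k)^2))))"
  using hard_instance by (intro exI[of _ "1 / 400"] exI[of _ 2]) simp

end
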